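(* Let $p,q\in\mathbb C\setminus\{0\}$, $M,N\in\mathbb N_0$ with $N\le M$, and $x,t\in\mathbb C$. Then $$\left[e^{t}\,{}_1F_1\!\left(\begin{matrix}-x\\ -N\end{matrix};-\frac{t}{p}\right)\right]_N=\sum_{n=0}^{N}\frac{(-M)_n}{(-N)_n\,n!}\left(\frac{tq}{p}\right)^n\left[e^t\,{}_1F_1\!\left(\begin{matrix}n-M\\ n-N\end{matrix};\frac{-tq}{p}\right)\right]_{N-n}K_n(x;q,M).$$
   Context: $\mathbb N_0=\{0,1,2,\dots\}$. Pochhammer symbol: $(a)_n=a(a+1)\cdots(a+n-1)$, $(a)_0=1$. ${}_1F_1\!\left(\begin{matrix}a\\ b\end{matrix};z\right)=\sum_{k\ge0}\frac{(a)_k}{(b)_k}\frac{z^k}{k!}$. Truncated Maclaurin expansion in $t$: $[f(t)]_N=\sum_{k=0}^N\frac{f^{(k)}(0)}{k!}t^k$, i.e. the partial sum through degree $N$ of the power series of $f$ in $t$. When the hypergeometric series inside $[\cdot]_L$ has lower parameter $-L$, only its terms of index $\le L$ (which are well defined) contribute, and the bracket is computed from these terms only. Krawtchouk polynomials, for $0\le n\le M$: $K_n(x;q,M)=\sum_{k=0}^n\frac{(-n)_k(-x)_k}{(-M)_k\,k!}\,q^{-k}$ (the ${}_2F_1(-n,-x;-M;1/q)$ understood as the sum up to index $n$). *)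

theory Defs
  imports "HOL-Analysis.Analysis"
begin

(* If b = -L with L a natural number, then pochhammer b k = 0 for all k > L, and since
   division by 0 yields 0 these terms vanish: the series consists of exactly the
   well-defined terms, those of index k \<le> L. *)
definition hyp_1F1 :: "complex \<Rightarrow> complex \<Rightarrow> complex \<Rightarrow> complex" where
  "hyp_1F1 a b z = (\<Sum>k. pochhammer a k / pochhammer b k * (z ^ k / fact k))"

definition maclaurin_trunc :: "nat \<Rightarrow> (complex \<Rightarrow> complex) \<Rightarrow> complex \<Rightarrow> complex" where
  "maclaurin_trunc N f t = (\<Sum>k\<le>N. (deriv ^^ k) f 0 / fact k * t ^ k)"

(* Meaningful for n \<le> M, where no denominator vanishes. *)
definition krawtchouk :: "nat \<Rightarrow> complex \<Rightarrow> complex \<Rightarrow> nat \<Rightarrow> complex" where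
  "krawtchouk n x q M =
     (\<Sum>k\<le>n. pochhammer (- of_nat n) k * pochhammer (- x) k
              / (pochhammer (- of_nat M) k * fact k) * (1 / q) ^ k)"

end

theory Submission
  imports Defs
begin

text \<open>
  Both sides are linear combinations of the functions \<open>t ^ k * exp_section (N - k) t\<close>,
  where \<open>exp_section L\<close> is the Taylor polynomial of degree \<open>L\<close> of the exponential
  function, and the two combinations have the same coefficients.

  These functions appear because truncating \<open>exp s * s ^ k\<close> at degree \<open>N \<ge> k\<close> leaves
  \<open>s ^ k * exp_section (N - k) s\<close>, and because a lower parameter \<open>- L\<close> turns the
  hypergeometric series into a polynomial of degree at most \<open>L\<close>; together this expands
  every bracket (\<open>maclaurin_trunc_exp_mult_hyp_1F1\<close>).

  On the right, the term of index \<open>i\<close> in the bracket of the \<open>n\<close>-th summand carries the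
  function with \<open>k = n + i\<close>. The Pochhammer symbols of \<open>- M\<close> and \<open>n - M\<close> multiply to
  the one of \<open>- M\<close> with index \<open>k\<close>, likewise for \<open>N\<close>, and the factorials and signs
  leave \<open>(-1) ^ n * (k choose n)\<close>. So the coefficient depends on \<open>n\<close> only through
  \<open>(-1) ^ n * (k choose n)\<close> times the \<open>n\<close>-th Krawtchouk polynomial. As a function of \<open>n\<close>,
  that polynomial is itself an alternating binomial transform
  (\<open>krawtchouk_binomial_transform\<close>), and this transform is an involution
  (\<open>binomial_inversion\<close>); summing over \<open>n\<close> therefore returns the single summand of
  index \<open>k\<close>, in which \<open>M\<close> and \<open>q\<close> cancel against the remaining factors:
  the Pochhammer symbol of \<open>- M\<close> does not vanish there, since \<open>k \<le> N \<le> M\<close>.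
\<close>

lemma sum_triangle_antidiagonal:
  fixes g :: "nat \<Rightarrow> nat \<Rightarrow> 'a::comm_monoid_add"
  shows "(\<Sum>n\<le>N. \<Sum>i\<le>N - n. g n i) = (\<Sum>k\<le>N. \<Sum>n\<le>k. g n (k - n))"
proof -
  have "(\<Sum>n\<le>N. \<Sum>i\<le>N - n. g n i) = (\<Sum>(n, i)\<in>(SIGMA n:{..N}. {..N - n}). g n i)"
    by (rule sum.Sigma) auto
  also have "(SIGMA n:{..N}. {..N - n}) = {(n, i). n + i \<le> N}"
    by auto
  finally show ?thesis
    by (simp add: sum.triangle_reindex_eq)
qed

text \<open>
  After the exchange of summations, \<open>(k choose n) * (n choose j) =
  (k choose j) * ((k - j) choose (n - j))\<close> reduces the inner sum to the binomial expansion
  of \<open>(1 - 1) ^ (k - j)\<close>, which vanishes except for \<open>j = k\<close>.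
\<close>

lemma binomial_inversion:
  fixes a :: "nat \<Rightarrow> 'a::comm_ring_1"
  shows "(\<Sum>n\<le>k. (-1) ^ n * of_nat (k choose n) * (\<Sum>j\<le>n. (-1) ^ j * of_nat (n choose j) * a j)) = a k"
proof -
  have "(\<Sum>n\<le>k. (-1) ^ n * of_nat (k choose n) * (\<Sum>j\<le>n. (-1) ^ j * of_nat (n choose j) * a j))
      = (\<Sum>n\<le>k. \<Sum>j\<le>n. (-1) ^ (n - j) * of_nat ((k choose n) * (n choose j)) * a j)"
    by (intro sum.cong refl) (auto simp: sum_distrib_left algebra_simps minus_one_power_iff intro!: sum.cong)
  also have "\<dots> = (\<Sum>n\<le>k. \<Sum>j\<le>n. (-1) ^ (n - j) * of_nat ((k choose j) * ((k - j) choose (n - j))) * a j)"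
    by (intro sum.cong refl) (simp add: choose_mult)
  also have "\<dots> = (\<Sum>j\<le>k. \<Sum>i\<le>k - j. (-1) ^ i * of_nat ((k choose j) * ((k - j) choose i)) * a j)"
    by (rule sum_triangle_antidiagonal [symmetric])
  also have "\<dots> = (\<Sum>j\<le>k. of_nat (k choose j) * a j * (\<Sum>i\<le>k - j. (-1) ^ i * of_nat ((k - j) choose i)))"
    by (simp add: sum_distrib_left algebra_simps)
  also have "\<dots> = (\<Sum>j\<le>k. if j = k then a j else 0)"
    by (intro sum.cong refl) (auto simp: choose_alternating_sum)
  finally show ?thesis
    by simp
qed

text \<open>
  The Pochhammer symbol of \<open>- n\<close> divided by \<open>k!\<close> is, up to the sign \<open>(-1) ^ k\<close>, the
  binomial coefficient \<open>n choose k\<close>. No other part of a summand depends on \<open>n\<close>, which is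
  what makes \<open>binomial_inversion\<close> applicable.
\<close>

lemma krawtchouk_binomial_transform:
  "krawtchouk n x q M =
    (\<Sum>k\<le>n. (-1) ^ k * of_nat (n choose k) * (pochhammer (- x) k / (pochhammer (- of_nat M) k * q ^ k)))"
  unfolding krawtchouk_def
  by (intro sum.cong refl)
     (simp add: binomial_gbinomial gbinomial_pochhammer power_one_over field_simps flip: power_mult_distrib)

definition exp_section :: "nat \<Rightarrow> complex \<Rightarrow> complex" where
  "exp_section L t = (\<Sum>l\<le>L. t ^ l / fact l)"

lemma maclaurin_trunc_conv_fps:
  assumes "f has_fps_expansion F"
  shows "maclaurin_trunc N f t = (\<Sum>k\<le>N. fps_nth F k * t ^ k)"
  unfolding maclaurin_trunc_def using fps_nth_fps_expansion [OF assms] by simp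

text \<open>
  The monomial \<open>s ^ k\<close> shifts the coefficients of the exponential series by \<open>k\<close> places, so
  those of index up to \<open>N - k\<close> survive the truncation.
\<close>

lemma maclaurin_trunc_exp_mult_polynomial:
  "maclaurin_trunc N (\<lambda>s. exp s * (\<Sum>k\<le>N. c k * s ^ k)) t
    = (\<Sum>k\<le>N. c k * t ^ k * exp_section (N - k) t)"
proof -
  define F where "F = fps_exp 1 * (\<Sum>k\<le>N. fps_const (c k) * fps_X ^ k)"
  have "(\<lambda>s. exp s * (\<Sum>k\<le>N. c k * s ^ k)) has_fps_expansion F"
    unfolding F_def by (intro fps_expansion_intros)
  then have "maclaurin_trunc N (\<lambda>s. exp s * (\<Sum>k\<le>N. c k * s ^ k)) t = (\<Sum>m\<le>N. fps_nth F m * t ^ m)"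
    by (rule maclaurin_trunc_conv_fps)
  also have "\<dots> = (\<Sum>m\<le>N. \<Sum>k\<le>m. c k * t ^ k * (t ^ (m - k) / fact (m - k)))"
  proof (intro sum.cong refl)
    fix m assume m: "m \<in> {..N}"
    have "F = (\<Sum>k\<le>N. fps_const (c k) * (fps_exp 1 * fps_X ^ k))"
      by (simp add: F_def sum_distrib_left mult_ac)
    then have "fps_nth F m = (\<Sum>k\<le>N. c k * (if m < k then 0 else 1 / fact (m - k)))"
      by (simp add: fps_sum_nth fps_X_power_mult_right_nth cong: if_cong)
    also have "\<dots> = (\<Sum>k\<le>m. c k / fact (m - k))"
      using m by (intro sum.mono_neutral_cong_right) auto
    finally show "fps_nth F m * t ^ m = (\<Sum>k\<le>m. c k * t ^ k * (t ^ (m - k) / fact (m - k)))"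
      by (auto simp: sum_distrib_right simp flip: power_add intro!: sum.cong)
  qed
  also have "\<dots> = (\<Sum>k\<le>N. \<Sum>l\<le>N - k. c k * t ^ k * (t ^ l / fact l))"
    by (rule sum_triangle_antidiagonal [symmetric])
  finally show ?thesis
    by (simp add: exp_section_def sum_distrib_left)
qed

text \<open>
  The terms beyond index \<open>L\<close> have denominator \<open>0\<close>, hence value \<open>0\<close>; the infinite sum
  is the polynomial formed by the well-defined terms.
\<close>

lemma hyp_1F1_neg_lower_parameter:
  "hyp_1F1 a (- of_nat L) z = (\<Sum>k\<le>L. pochhammer a k / pochhammer (- of_nat L) k * (z ^ k / fact k))"
  unfolding hyp_1F1_def by (rule suminf_finite) (auto simp: pochhammer_of_nat_eq_0_iff)

lemma maclaurin_trunc_exp_mult_hyp_1F1: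
  "maclaurin_trunc L (\<lambda>s. exp s * hyp_1F1 a (- of_nat L) (c * s)) t =
    (\<Sum>k\<le>L. pochhammer a k / pochhammer (- of_nat L) k * (c ^ k / fact k) * t ^ k * exp_section (L - k) t)"
  using maclaurin_trunc_exp_mult_polynomial
    [of L "\<lambda>k. pochhammer a k / pochhammer (- of_nat L) k * (c ^ k / fact k)" t]
  by (simp add: hyp_1F1_neg_lower_parameter power_mult_distrib mult_ac)

theorem theorem15:
  fixes p q x t :: complex and M N :: nat
  assumes "p \<noteq> 0" and "q \<noteq> 0" and "N \<le> M"
  shows "maclaurin_trunc N (\<lambda>s. exp s * hyp_1F1 (- x) (- of_nat N) (- s / p)) t =
    (\<Sum>n\<le>N. pochhammer (- of_nat M) n / (pochhammer (- of_nat N) n * fact n) * (t * q / p) ^ n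
       * maclaurin_trunc (N - n)
           (\<lambda>s. exp s * hyp_1F1 (of_nat n - of_nat M) (of_nat n - of_nat N) (- s * q / p)) t
       * krawtchouk n x q M)"
proof -
  \<comment> \<open>What the pairs \<open>(n, i)\<close> with \<open>n + i = k\<close> have in common on the right-hand side.\<close>
  define w where "w k = pochhammer (- of_nat M) k / pochhammer (- of_nat N) k * ((- q / p) ^ k / fact k)
      * t ^ k * exp_section (N - k) t" for k
  have term_eq: "pochhammer (- of_nat M) n / (pochhammer (- of_nat N) n * fact n) * (t * q / p) ^ n
      * (pochhammer (of_nat n - of_nat M) i / pochhammer (of_nat n - of_nat N) i * ((- q / p) ^ i / fact i)
          * t ^ i * exp_section (N - n - i) t)
    = (-1) ^ n * of_nat ((n + i) choose n) * w (n + i)" for n i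
  proof -
    have poch: "pochhammer (- of_nat L) (n + i)
        = pochhammer (- of_nat L) n * pochhammer (of_nat n - of_nat L :: complex) i" for L
      by (simp add: pochhammer_product')
    have pow: "(t * q / p) ^ n = (-1) ^ n * (- q / p) ^ n * t ^ n"
      by (simp flip: power_mult_distrib add: mult_ac)
    have "(of_nat ((n + i) choose n) :: complex) = fact (n + i) / (fact n * fact i)"
      by (simp add: binomial_fact)
    then show ?thesis
      unfolding w_def poch pow by (simp add: power_add mult_ac)
  qed
  have rhs_bracket: "maclaurin_trunc (N - n)
        (\<lambda>s. exp s * hyp_1F1 (of_nat n - of_nat M) (of_nat n - of_nat N) (- s * q / p)) t
      = (\<Sum>i\<le>N - n. pochhammer (of_nat n - of_nat M) i / pochhammer (of_nat n - of_nat N) i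
          * ((- q / p) ^ i / fact i) * t ^ i * exp_section (N - n - i) t)" if "n \<le> N" for n
    using maclaurin_trunc_exp_mult_hyp_1F1 [of "N - n" "of_nat n - of_nat M" "- q / p" t] that
    by (simp add: of_nat_diff mult_ac)
  have "(\<Sum>n\<le>N. pochhammer (- of_nat M) n / (pochhammer (- of_nat N) n * fact n) * (t * q / p) ^ n
       * maclaurin_trunc (N - n)
           (\<lambda>s. exp s * hyp_1F1 (of_nat n - of_nat M) (of_nat n - of_nat N) (- s * q / p)) t
       * krawtchouk n x q M)
      = (\<Sum>n\<le>N. \<Sum>i\<le>N - n. (-1) ^ n * of_nat ((n + i) choose n) * w (n + i) * krawtchouk n x q M)"
    by (intro sum.cong refl) (simp only: rhs_bracket sum_distrib_left sum_distrib_right atMost_iff flip: term_eq)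
  also have "\<dots> = (\<Sum>k\<le>N. w k * (\<Sum>n\<le>k. (-1) ^ n * of_nat (k choose n) * krawtchouk n x q M))"
    by (subst sum_triangle_antidiagonal) (simp add: sum_distrib_left mult_ac)
  also have "\<dots> = (\<Sum>k\<le>N. w k * (pochhammer (- x) k / (pochhammer (- of_nat M) k * q ^ k)))"
    by (simp only: krawtchouk_binomial_transform binomial_inversion)
  also have "\<dots> = (\<Sum>k\<le>N. pochhammer (- x) k / pochhammer (- of_nat N) k * ((- 1 / p) ^ k / fact k)
      * t ^ k * exp_section (N - k) t)"
  proof (intro sum.cong refl)
    fix k assume "k \<in> {..N}"
    then have "pochhammer (- of_nat M :: complex) k \<noteq> 0"
      using \<open>N \<le> M\<close> by (simp add: pochhammer_of_nat_eq_0_iff)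
    moreover have "(- q / p) ^ k = (- 1 / p) ^ k * q ^ k"
      by (simp flip: power_mult_distrib)
    ultimately show "w k * (pochhammer (- x) k / (pochhammer (- of_nat M) k * q ^ k))
      = pochhammer (- x) k / pochhammer (- of_nat N) k * ((- 1 / p) ^ k / fact k)
          * t ^ k * exp_section (N - k) t"
      using \<open>q \<noteq> 0\<close> by (simp add: w_def)
  qed
  also have "\<dots> = maclaurin_trunc N (\<lambda>s. exp s * hyp_1F1 (- x) (- of_nat N) (- s / p)) t"
    using maclaurin_trunc_exp_mult_hyp_1F1 [of N "- x" "- 1 / p" t] by simp
  finally show ?thesis ..
qed

end
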